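(* Let $d\ge 1$, $\alpha\ge 1$, $N\ge 0$, $\beta\ge 1$, and let $S=\{s_1,\dots,s_n\}\subset\mathbb{R}^d$ ($n\ge 2$) be stations with powers $\psi_1,\dots,\psi_n>0$. Embed the stations in $\mathbb{R}^{d+1}$ as the points $(s_i,0)$ of the hyperplane $x_{d+1}=0$, and for $p\in\mathbb{R}^{d+1}$ not a station set $$\mathrm{SINR}(s_i,p)=\frac{\psi_i\,\|(s_i,0)-p\|^{-2\alpha}}{\sum_{j\ne i}\psi_j\,\|(s_j,0)-p\|^{-2\alpha}+N},$$ (path-loss exponent $2\alpha\ge 2$). Define $H_i^{(d+1)}=\{p\in\mathbb{R}^{d+1}\setminus\{(s_1,0),\dots,(s_n,0)\}:\mathrm{SINR}(s_i,p)\ge\beta\}\cup\{(s_i,0)\}$. Then $H_i^{(d+1)}$ is connected for every $i\in\{1,\dots,n\}$.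
   Context: Here $\|\cdot\|$ is the Euclidean norm in $\mathbb{R}^{d+1}$. The set $H_i^{(d+1)}$ is the reception zone of station $s_i$ in the $(d+1)$-dimensional map of a network whose stations lie in $\mathbb{R}^d$. *)

theory Defs
  imports "HOL-Analysis.Analysis"
begin

text \<open>
  The space of dimension d + 1 is rendered as \<open>(real ^ 'd) \<times> real\<close>, the last coordinate being the
  second component. The library norm of this product is the Euclidean one,
  \<open>norm (x, y) = sqrt ((norm x)\<^sup>2 + (norm y)\<^sup>2)\<close>.
  A type of class \<open>finite\<close> is nonempty, so d = \<open>CARD('d)\<close> is at least 1.
\<close>

definition embed_station :: "real ^ 'd \<Rightarrow> (real ^ 'd) \<times> real" where
  "embed_station x = (x, 0)"

text \<open>
  Stations are indexed by \<open>{1..n}\<close>. The path-loss exponent is \<open>2 * \<alpha>\<close>. As in the source, the value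
  of \<open>SINR\<close> is meaningful only at points \<open>p\<close> that are not stations: there every norm is positive,
  so that \<open>powr\<close> is the usual real power, and the denominator is positive when there are at least
  two stations.
\<close>

definition SINR ::
  "nat \<Rightarrow> (nat \<Rightarrow> real ^ 'd) \<Rightarrow> (nat \<Rightarrow> real) \<Rightarrow> real \<Rightarrow> real \<Rightarrow> nat \<Rightarrow> (real ^ 'd) \<times> real \<Rightarrow> real"
where
  "SINR n s \<psi> N \<alpha> i p =
     (\<psi> i * norm (embed_station (s i) - p) powr (- (2 * \<alpha>))) /
     ((\<Sum>j\<in>{1..n} - {i}. \<psi> j * norm (embed_station (s j) - p) powr (- (2 * \<alpha>))) + N)"

definition reception_zone ::
  "nat \<Rightarrow> (nat \<Rightarrow> real ^ 'd) \<Rightarrow> (nat \<Rightarrow> real) \<Rightarrow> real \<Rightarrow> real \<Rightarrow> real \<Rightarrow> nat \<Rightarrow> ((real ^ 'd) \<times> real) set"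
where
  "reception_zone n s \<psi> N \<beta> \<alpha> i =
     {p. p \<notin> (\<lambda>j. embed_station (s j)) ` {1..n} \<and> SINR n s \<psi> N \<alpha> i p \<ge> \<beta>}
     \<union> {embed_station (s i)}"

end

theory Submission
  imports Defs "HOL-Real_Asymp.Real_Asymp"
begin

text \<open>
  Put the station \<open>s\<^sub>i\<close> at the origin. Inversion \<open>(x, y) \<mapsto> (u, w) = (x / q, 1 / q)\<close> with
  \<open>q = \<parallel>x\<parallel>\<^sup>2 + y\<^sup>2\<close> maps either closed half-space \<open>y \<ge> 0\<close>, \<open>y \<le> 0\<close> without the origin
  bijectively onto the convex set \<open>\<parallel>u\<parallel>\<^sup>2 \<le> w\<close>, \<open>w > 0\<close>. Since the stations lie in the hyperplane
  \<open>y = 0\<close>, the ratio of the squared distances to \<open>s\<^sub>j\<close> and \<open>s\<^sub>i\<close> becomes the function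
  \<open>1 - 2 u \<bullet> s\<^sub>j + \<parallel>s\<^sub>j\<parallel>\<^sup>2 w\<close>, which is affine in \<open>(u, w)\<close>. The inverse of SINR is therefore convex
  in \<open>(u, w)\<close>, so each half of the zone is a continuous image of a convex set. It is also
  nonincreasing in \<open>w\<close>, so letting \<open>w\<close> tend to infinity shows that \<open>s\<^sub>i\<close> is a limit point of each
  half, and the two halves are joined at \<open>s\<^sub>i\<close>.
\<close>

section \<open>Convexity in the inverted coordinates\<close>

lemma convex_on_powr_neg:
  fixes a :: real
  assumes "a \<ge> 0"
  shows "convex_on {0<..} (\<lambda>x. x powr (- a))"
proof (rule f''_ge0_imp_convex)
  fix x :: real assume "x \<in> {0<..}"
  then have x: "x > 0" by simp
  show "((\<lambda>x. x powr (- a)) has_real_derivative (- a) * x powr (- a - 1)) (at x)"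
    using x by (auto intro!: derivative_eq_intros)
  show "((\<lambda>x. (- a) * x powr (- a - 1)) has_real_derivative
          (- a) * ((- a - 1) * x powr (- a - 1 - 1))) (at x)"
    using x by (auto intro!: derivative_eq_intros)
  have "0 \<le> (a * (a + 1)) * x powr (- a - 1 - 1)"
    using assms by simp
  then show "0 \<le> (- a) * ((- a - 1) * x powr (- a - 1 - 1))"
    by (simp add: algebra_simps)
qed simp

text \<open>The squared distance from \<open>(t, 0)\<close> to \<open>(x, y)\<close> is q - 2 (x
  \<bullet> t) + |t|^2 with q = |x|^2 + y^2; dividing by q and substituting u = x / q, w = 1 / q
  gives this formula.\<close>

definition dist_ratio :: "'a::real_inner \<Rightarrow> 'a \<times> real \<Rightarrow> real" where
  "dist_ratio t z = 1 - 2 * (fst z \<bullet> t) + (norm t)\<^sup>2 * snd z"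

lemma dist_ratio_zero [simp]: "dist_ratio 0 z = 1"
  by (simp add: dist_ratio_def)

lemma dist_ratio_convex_combination:
  assumes "a + b = 1"
  shows "dist_ratio t (a *\<^sub>R x + b *\<^sub>R y) = a * dist_ratio t x + b * dist_ratio t y"
proof -
  have a: "a = 1 - b" using assms by simp
  show ?thesis
    unfolding a dist_ratio_def by (simp add: inner_add_left algebra_simps)
qed

text \<open>Under the inversion w - |u|^2 = (y / q)^2, so the surface w = |u|^2 comes from the
  hyperplane y = 0. The condition 0 < w excludes only the origin, which would correspond to the
  point at infinity.\<close>

definition paraboloid_region :: "('a::real_inner \<times> real) set" where
  "paraboloid_region = {z. 0 < snd z \<and> (norm (fst z))\<^sup>2 \<le> snd z}"

text \<open>The gap between the two sides is exactly a b |x - y|^2.\<close>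

lemma convex_norm_square_le:
  fixes x y :: "'a::real_inner"
  assumes "a \<ge> 0" "b \<ge> 0" "a + b = (1::real)"
  shows "(norm (a *\<^sub>R x + b *\<^sub>R y))\<^sup>2 \<le> a * (norm x)\<^sup>2 + b * (norm y)\<^sup>2"
proof -
  have a: "a = 1 - b" using assms by simp
  have "a * (norm x)\<^sup>2 + b * (norm y)\<^sup>2 - (norm (a *\<^sub>R x + b *\<^sub>R y))\<^sup>2 = a * b * (norm (x - y))\<^sup>2"
    unfolding a power2_norm_eq_inner
    by (simp add: inner_add_left inner_add_right inner_diff_left inner_diff_right
        inner_commute algebra_simps power2_eq_square)
  moreover have "0 \<le> a * b * (norm (x - y))\<^sup>2" using assms by simp
  ultimately show ?thesis by linarith
qed

lemma convex_paraboloid_region: "convex (paraboloid_region :: ('a::real_inner \<times> real) set)"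
proof (rule convexI)
  fix x y :: "'a \<times> real" and a b :: real
  assume x: "x \<in> paraboloid_region" and y: "y \<in> paraboloid_region"
    and ab: "0 \<le> a" "0 \<le> b" "a + b = 1"
  \<comment> \<open>One weight may vanish, so strict positivity is taken from convexity of the open
    half-line rather than term by term.\<close>
  have "0 < a * snd x + b * snd y"
    using convexD[OF convex_real_interval(3)[of 0], of "snd x" "snd y" a b] x y ab
    by (auto simp: paraboloid_region_def)
  moreover have "(norm (a *\<^sub>R fst x + b *\<^sub>R fst y))\<^sup>2 \<le> a * snd x + b * snd y"
  proof -
    have "a * (norm (fst x))\<^sup>2 + b * (norm (fst y))\<^sup>2 \<le> a * snd x + b * snd y"
      using x y ab by (intro add_mono mult_left_mono) (auto simp: paraboloid_region_def)
    then show ?thesis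
      using convex_norm_square_le[OF ab, of "fst x" "fst y"] by linarith
  qed
  ultimately show "a *\<^sub>R x + b *\<^sub>R y \<in> paraboloid_region"
    by (simp add: paraboloid_region_def)
qed

text \<open>The inequality is the reciprocal form of SINR \<ge> \<beta>, with \<open>K\<close>
  standing for \<open>\<psi> i / \<beta>\<close>; the noise carries w^(-\<alpha>) because it is
  divided by the path loss w^\<alpha> to the central station. Positivity of the ratios is a separate
  condition because \<open>0 powr (- \<alpha>) = 0\<close>: at another station the sum would miss
  the singularity.\<close>

definition inverted_zone ::
  "'i set \<Rightarrow> ('i \<Rightarrow> 'a::real_inner) \<Rightarrow> ('i \<Rightarrow> real) \<Rightarrow> real \<Rightarrow> real \<Rightarrow> real \<Rightarrow> ('a \<times> real) set"
where
  "inverted_zone J t c N \<alpha> K =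
     {z \<in> paraboloid_region. (\<forall>j\<in>J. 0 < dist_ratio (t j) z) \<and>
        (\<Sum>j\<in>J. c j * dist_ratio (t j) z powr (- \<alpha>)) + N * snd z powr (- \<alpha>) \<le> K}"

text \<open>A sublevel set of a nonnegative combination of convex powers of affine functions, cut
  down by convex constraints.\<close>

lemma convex_inverted_zone:
  fixes t :: "'i \<Rightarrow> 'a::real_inner"
  assumes "\<alpha> \<ge> 0" "N \<ge> 0" "\<And>j. j \<in> J \<Longrightarrow> c j \<ge> 0"
  shows "convex (inverted_zone J t c N \<alpha> K)"
proof (rule convexI)
  fix x y :: "'a \<times> real" and a b :: real
  assume x: "x \<in> inverted_zone J t c N \<alpha> K" and y: "y \<in> inverted_zone J t c N \<alpha> K"
    and ab: "0 \<le> a" "0 \<le> b" "a + b = 1"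
  let ?z = "a *\<^sub>R x + b *\<^sub>R y"
  have region: "?z \<in> paraboloid_region"
    using convexD[OF convex_paraboloid_region, of x y] x y ab by (auto simp: inverted_zone_def)
  have conv: "(a * p + b * q) powr (- \<alpha>) \<le> a * p powr (- \<alpha>) + b * q powr (- \<alpha>)"
    if "0 < p" "0 < q" for p q
  proof -
    have "(a *\<^sub>R p + b *\<^sub>R q) powr (- \<alpha>) \<le> a * p powr (- \<alpha>) + b * q powr (- \<alpha>)"
      using convex_on_powr_neg[OF assms(1)] that ab unfolding convex_on_def by blast
    then show ?thesis by simp
  qed
  have pos: "0 < dist_ratio (t j) ?z" if "j \<in> J" for j
  proof -
    have "0 < dist_ratio (t j) x" "0 < dist_ratio (t j) y"
      using x y that by (simp_all add: inverted_zone_def)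
    then show ?thesis
      unfolding dist_ratio_convex_combination[OF ab(3)]
      using convexD[OF convex_real_interval(3)[of 0],
          of "dist_ratio (t j) x" "dist_ratio (t j) y" a b] ab by simp
  qed
  define S where "S z = (\<Sum>j\<in>J. c j * dist_ratio (t j) z powr (- \<alpha>))" for z
  have "S ?z \<le> (\<Sum>j\<in>J. c j * (a * dist_ratio (t j) x powr (- \<alpha>) + b * dist_ratio (t j) y powr (- \<alpha>)))"
    unfolding S_def dist_ratio_convex_combination[OF ab(3)]
  proof (intro sum_mono mult_left_mono conv)
    fix j assume "j \<in> J"
    then show "0 < dist_ratio (t j) x" "0 < dist_ratio (t j) y" "0 \<le> c j"
      using x y assms(3) by (simp_all add: inverted_zone_def)
  qed
  also have "\<dots> = a * S x + b * S y"
    by (simp add: S_def sum_distrib_left sum.distrib distrib_left mult.left_commute)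
  finally have "S ?z \<le> a * S x + b * S y" .
  moreover have "N * snd ?z powr (- \<alpha>) \<le> N * (a * snd x powr (- \<alpha>) + b * snd y powr (- \<alpha>))"
    using conv[of "snd x" "snd y"] x y assms(2)
    by (intro mult_left_mono) (simp_all add: inverted_zone_def paraboloid_region_def)
  ultimately have "S ?z + N * snd ?z powr (- \<alpha>) \<le>
      a * (S x + N * snd x powr (- \<alpha>)) + b * (S y + N * snd y powr (- \<alpha>))"
    by (simp add: distrib_left mult.left_commute)
  also have "\<dots> \<le> K"
    using x y ab by (intro convex_bound_le) (simp_all add: inverted_zone_def S_def)
  finally have "(\<Sum>j\<in>J. c j * dist_ratio (t j) ?z powr (- \<alpha>)) + N * snd ?z powr (- \<alpha>) \<le> K"
    by (simp only: S_def)
  with region pos show "?z \<in> inverted_zone J t c N \<alpha> K"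
    by (simp add: inverted_zone_def)
qed

text \<open>The coefficient |t|^2 of w in each ratio is nonnegative, so raising w raises every base,
  and powers with exponent -\<alpha> do not increase.\<close>

lemma inverted_zone_upward:
  assumes "\<alpha> \<ge> 0" "N \<ge> 0" "\<And>j. j \<in> J \<Longrightarrow> c j \<ge> 0"
    and z: "(u, w) \<in> inverted_zone J t c N \<alpha> K" and "w \<le> w'"
  shows "(u, w') \<in> inverted_zone J t c N \<alpha> K"
proof -
  have le: "dist_ratio (t j) (u, w) \<le> dist_ratio (t j) (u, w')" for j
    using \<open>w \<le> w'\<close> by (simp add: dist_ratio_def mult_left_mono)
  have "(\<Sum>j\<in>J. c j * dist_ratio (t j) (u, w') powr (- \<alpha>)) + N * w' powr (- \<alpha>) \<le>
      (\<Sum>j\<in>J. c j * dist_ratio (t j) (u, w) powr (- \<alpha>)) + N * w powr (- \<alpha>)"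
    using z le assms
    by (intro add_mono sum_mono mult_left_mono powr_mono2')
      (auto simp: inverted_zone_def paraboloid_region_def)
  with z le \<open>w \<le> w'\<close> show ?thesis
    by (fastforce simp: inverted_zone_def paraboloid_region_def intro: less_le_trans)
qed

section \<open>The inversion and its effect on distances\<close>

text \<open>The parameter \<open>\<sigma> = \<plusminus>1\<close> selects the half-space that contains the image.\<close>

definition uninvert :: "real \<Rightarrow> 'a::real_inner \<Rightarrow> 'a \<times> real \<Rightarrow> 'a \<times> real" where
  "uninvert \<sigma> b z =
     (b + (1 / snd z) *\<^sub>R fst z, \<sigma> * sqrt (snd z - (norm (fst z))\<^sup>2) / snd z)"

lemma continuous_on_uninvert: "continuous_on paraboloid_region (uninvert \<sigma> b)"
  unfolding uninvert_def by (intro continuous_intros) (auto simp: paraboloid_region_def)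

text \<open>Since \<open>(x, 0)\<close> lies in the hyperplane, the last coordinate enters only
  through its square and the sign drops out. Its term -|u|^2 / w^2 cancels the quadratic term of the
  first component, leaving an affine function of z over w.\<close>

lemma norm_square_diff_uninvert:
  assumes z: "z \<in> paraboloid_region" and \<sigma>: "\<sigma>\<^sup>2 = 1"
  shows "(norm ((x, 0) - uninvert \<sigma> b z))\<^sup>2 = dist_ratio (x - b) z / snd z"
proof -
  obtain u w where [simp]: "z = (u, w)" by (cases z)
  have w: "w > 0" "(norm u)\<^sup>2 \<le> w" using z by (auto simp: paraboloid_region_def)
  define t where "t = x - b"
  have "(norm ((x, 0) - uninvert \<sigma> b z))\<^sup>2 =
      (norm (t - (1 / w) *\<^sub>R u))\<^sup>2 + (w - (norm u)\<^sup>2) / w\<^sup>2"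
    using w \<sigma> by (simp add: uninvert_def norm_Pair power_divide power_mult_distrib t_def algebra_simps)
  also have "(norm (t - (1 / w) *\<^sub>R u))\<^sup>2 = (norm t)\<^sup>2 - 2 * (u \<bullet> t) / w + (norm u)\<^sup>2 / w\<^sup>2"
    unfolding power2_norm_eq_inner
    by (simp add: inner_diff_left inner_diff_right inner_commute power2_eq_square algebra_simps)
  also have "(w - (norm u)\<^sup>2) / w\<^sup>2 = 1 / w - (norm u)\<^sup>2 / w\<^sup>2"
    using w(1) by (simp add: diff_divide_distrib power2_eq_square)
  also have "(norm t)\<^sup>2 - 2 * (u \<bullet> t) / w + (norm u)\<^sup>2 / w\<^sup>2 + (1 / w - (norm u)\<^sup>2 / w\<^sup>2) =
      dist_ratio t z / w"
    using w(1) by (simp add: dist_ratio_def field_simps)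
  finally show ?thesis
    by (simp add: t_def)
qed

lemma uninvert_surj:
  fixes p :: "'a::real_inner \<times> real"
  assumes "p \<noteq> (b, 0)"
  shows "\<exists>\<sigma>\<in>{1, -1}. \<exists>z\<in>paraboloid_region. p = uninvert \<sigma> b z"
proof -
  obtain x y where p: "p = (b + x, y)"
    by (metis add.commute diff_add_cancel prod.exhaust)
  define q where "q = (norm x)\<^sup>2 + y\<^sup>2"
  have "x \<noteq> 0 \<or> y \<noteq> 0" using assms p by auto
  then have q: "q > 0"
    by (auto simp: q_def add_pos_nonneg add_nonneg_pos)
  \<comment> \<open>The square root in \<open>uninvert\<close> recovers only |y| / q; this factor
    restores the sign of y.\<close>
  define \<sigma> :: real where "\<sigma> = (if y \<ge> 0 then 1 else -1)"
  define z where "z = ((1 / q) *\<^sub>R x, 1 / q)"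
  have "(y / q)\<^sup>2 = (q - (norm x)\<^sup>2) / q\<^sup>2"
    by (simp add: q_def power_divide)
  also have "\<dots> = 1 / q - (norm x / q)\<^sup>2"
    using q by (simp add: diff_divide_distrib power_divide power2_eq_square)
  also have "\<dots> = snd z - (norm (fst z))\<^sup>2"
    using q by (simp add: z_def)
  finally have eq: "snd z - (norm (fst z))\<^sup>2 = (y / q)\<^sup>2" ..
  have "snd z > 0" using q by (simp add: z_def)
  moreover have "(norm (fst z))\<^sup>2 \<le> snd z"
    using eq zero_le_power2[of "y / q"] by linarith
  ultimately have "z \<in> paraboloid_region"
    by (simp add: paraboloid_region_def)
  moreover have "p = uninvert \<sigma> b z"
    unfolding uninvert_def eq real_sqrt_abs using q by (simp add: p z_def \<sigma>_def)
  moreover have "\<sigma> \<in> {1, -1}" by (simp add: \<sigma>_def)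
  ultimately show ?thesis by blast
qed

section \<open>Connectedness of each half together with its station\<close>

lemma tendsto_uninvert_at_top:
  "((\<lambda>w. uninvert \<sigma> b (u, w)) \<longlongrightarrow> (b, 0)) at_top"
proof -
  have "((\<lambda>w::real. 1 / w) \<longlongrightarrow> 0) at_top" by real_asymp
  then have "((\<lambda>w. b + (1 / w) *\<^sub>R u) \<longlongrightarrow> b + 0 *\<^sub>R u) at_top"
    by (intro tendsto_intros)
  moreover have "((\<lambda>w. \<sigma> * sqrt (w - (norm u)\<^sup>2) / w) \<longlongrightarrow> 0) at_top" by real_asymp
  ultimately show ?thesis by (auto simp: uninvert_def intro: tendsto_Pair)
qed

text \<open>The image of the convex set is connected, and adjoining a point of its closure keeps it
  so. The station is such a point: it is the limit along a vertical ray, which stays in the zone by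
  upward closure. If the zone is empty, only a singleton remains.\<close>

lemma connected_insert_uninvert_image:
  assumes "\<alpha> \<ge> 0" "N \<ge> 0" "\<And>j. j \<in> J \<Longrightarrow> c j \<ge> 0"
  shows "connected (insert (b, 0) (uninvert \<sigma> b ` inverted_zone J t c N \<alpha> K))"
proof (cases "inverted_zone J t c N \<alpha> K = {}")
  case False
  let ?Z = "inverted_zone J t c N \<alpha> K"
  obtain u w where uw: "(u, w) \<in> ?Z" using False by auto
  have "\<forall>\<^sub>F w' in at_top. uninvert \<sigma> b (u, w') \<in> closure (uninvert \<sigma> b ` ?Z)"
    using eventually_ge_at_top[of w]
  proof (rule eventually_mono)
    fix w' assume "w \<le> w'"
    then have "(u, w') \<in> ?Z"
      using inverted_zone_upward[of \<alpha> N J c u w t K w'] assms uw by blast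
    then show "uninvert \<sigma> b (u, w') \<in> closure (uninvert \<sigma> b ` ?Z)"
      by (intro subsetD[OF closure_subset] imageI)
  qed
  then have "(b, 0) \<in> closure (uninvert \<sigma> b ` ?Z)"
    by (intro Lim_in_closed_set[OF closed_closure _ trivial_limit_at_top_linorder
        tendsto_uninvert_at_top[of \<sigma> b u]])
  moreover have "connected (uninvert \<sigma> b ` ?Z)"
    by (intro connected_continuous_image continuous_on_subset[OF continuous_on_uninvert]
        convex_connected convex_inverted_zone assms) (auto simp: inverted_zone_def)
  ultimately show ?thesis
    using connected_intermediate_closure[OF _ subset_insertI] closure_subset
    by (metis insert_subset)
qed simp

section \<open>Translation of the SINR condition\<close>

lemma uninvert_mem_reception_zone_iff:
  fixes s :: "nat \<Rightarrow> real ^ 'd"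
  assumes "N \<ge> 0" "\<beta> > 0" "n \<ge> 2" "\<And>j. j \<in> {1..n} \<Longrightarrow> \<psi> j > 0"
    and i: "i \<in> {1..n}" and z: "z \<in> paraboloid_region" and \<sigma>: "\<sigma>\<^sup>2 = 1"
  shows "uninvert \<sigma> (s i) z \<in> reception_zone n s \<psi> N \<beta> \<alpha> i \<longleftrightarrow>
    z \<in> inverted_zone ({1..n} - {i}) (\<lambda>j. s j - s i) \<psi> N \<alpha> (\<psi> i / \<beta>)"
proof -
  let ?p = "uninvert \<sigma> (s i) z" and ?J = "{1..n} - {i}" and ?w = "snd z"
  let ?A = "\<lambda>j. dist_ratio (s j - s i) z"
  let ?S = "\<Sum>j\<in>?J. \<psi> j * ?A j powr (- \<alpha>)"
  have w: "?w > 0" using z by (simp add: paraboloid_region_def)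
  have sq: "(norm (embed_station (s j) - ?p))\<^sup>2 = ?A j / ?w" for j
    unfolding embed_station_def by (rule norm_square_diff_uninvert[OF z \<sigma>])
  have A_nonneg: "?A j \<ge> 0" for j
    using sq[of j] w by (metis zero_le_power2 zero_le_divide_iff not_less less_imp_le order_antisym)
  have pow: "norm (embed_station (s j) - ?p) powr (- (2 * \<alpha>)) = ?A j powr (- \<alpha>) * ?w powr \<alpha>" for j
  proof -
    have "norm (embed_station (s j) - ?p) powr (- (2 * \<alpha>)) =
        ((norm (embed_station (s j) - ?p))\<^sup>2) powr (- \<alpha>)"
      by (simp add: powr_powr flip: powr_realpow' powr_numeral)
    also have "\<dots> = ?A j powr (- \<alpha>) * ?w powr \<alpha>"
      unfolding sq using A_nonneg[of j] w by (simp add: powr_divide powr_minus_divide)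
    finally show ?thesis .
  qed
  have station: "embed_station (s j) = ?p \<longleftrightarrow> ?A j = 0" for j
    using sq[of j] w by auto
  \<comment> \<open>The ratio for station i itself is \<open>dist_ratio 0 z = 1\<close>, which is
    nonzero.\<close>
  have ne: "?p \<noteq> embed_station (s i)"
    using station[of i] by auto
  have "?p \<notin> (\<lambda>j. embed_station (s j)) ` {1..n} \<longleftrightarrow> (\<forall>j\<in>?J. 0 < ?A j)"
    using station A_nonneg ne by (force simp: less_le)
  moreover have "SINR n s \<psi> N \<alpha> i ?p \<ge> \<beta> \<longleftrightarrow> ?S + N * ?w powr (- \<alpha>) \<le> \<psi> i / \<beta>"
    if pos: "\<forall>j\<in>?J. 0 < ?A j"
  proof -
    \<comment> \<open>A second station makes the interference, hence the denominator, positive even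
      when N = 0.\<close>
    have "(if i = 1 then 2 else 1) \<in> ?J"
      using \<open>n \<ge> 2\<close> by auto
    then have "?J \<noteq> {}" by blast
    moreover have "0 < \<psi> j * ?A j powr (- \<alpha>)" if "j \<in> ?J" for j
      using assms(4)[of j] bspec[OF pos that] that by simp
    ultimately have "?S > 0"
      by (intro sum_pos) simp_all
    then have D: "?S + N * ?w powr (- \<alpha>) > 0"
      using \<open>N \<ge> 0\<close> by (intro add_pos_nonneg) auto
    have "SINR n s \<psi> N \<alpha> i ?p = (\<psi> i * ?w powr \<alpha>) / (?S * ?w powr \<alpha> + N)"
      unfolding SINR_def pow by (simp add: sum_distrib_right mult.assoc)
    \<comment> \<open>Writing N as N w^(-\<alpha>) w^\<alpha> exposes the factor w^\<alpha> shared
      with the numerator.\<close>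
    also have "?S * ?w powr \<alpha> + N = (?S + N * ?w powr (- \<alpha>)) * ?w powr \<alpha>"
      using w by (simp add: distrib_right mult.assoc flip: powr_add)
    also have "(\<psi> i * ?w powr \<alpha>) / \<dots> = \<psi> i / (?S + N * ?w powr (- \<alpha>))"
      using w by simp
    finally have "SINR n s \<psi> N \<alpha> i ?p = \<psi> i / (?S + N * ?w powr (- \<alpha>))" .
    then show ?thesis
      by (simp only: pos_le_divide_eq[OF D] pos_le_divide_eq[OF \<open>\<beta> > 0\<close>] mult.commute)
  qed
  ultimately show ?thesis
    using z ne by (auto simp: reception_zone_def inverted_zone_def)
qed

theorem theorem6p1:
  fixes n :: nat
    and s :: "nat \<Rightarrow> real ^ 'd"
    and \<psi> :: "nat \<Rightarrow> real"
    and \<alpha> N \<beta> :: real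
  assumes "\<alpha> \<ge> 1" and "N \<ge> 0" and "\<beta> \<ge> 1"
    and "n \<ge> 2"
    and "\<And>i. i \<in> {1..n} \<Longrightarrow> \<psi> i > 0"
  shows "\<forall>i\<in>{1..n}. connected (reception_zone n s \<psi> N \<beta> \<alpha> i)"
proof
  fix i assume i: "i \<in> {1..n}"
  let ?H = "reception_zone n s \<psi> N \<beta> \<alpha> i"
  let ?Z = "inverted_zone ({1..n} - {i}) (\<lambda>j. s j - s i) \<psi> N \<alpha> (\<psi> i / \<beta>)"
  let ?half = "\<lambda>\<sigma>. insert (s i, 0) (uninvert \<sigma> (s i) ` ?Z)"
  have "\<beta> > 0" using assms by simp
  have mem_iff: "uninvert \<sigma> (s i) z \<in> ?H \<longleftrightarrow> z \<in> ?Z"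
    if "\<sigma> \<in> {1, -1}" "z \<in> paraboloid_region" for \<sigma> z
  proof -
    have "\<sigma>\<^sup>2 = 1" using that(1) by auto
    then show ?thesis
      using uninvert_mem_reception_zone_iff[of N \<beta> n \<psi> i z \<sigma> s \<alpha>]
        assms(2,4,5) \<open>\<beta> > 0\<close> i that(2) by blast
  qed
  have "?half \<sigma> \<subseteq> ?H" if "\<sigma> \<in> {1, -1}" for \<sigma>
  proof -
    have "z \<in> paraboloid_region" if "z \<in> ?Z" for z
      using that by (simp add: inverted_zone_def)
    then have "uninvert \<sigma> (s i) ` ?Z \<subseteq> ?H"
      using mem_iff[OF that] by (intro image_subsetI) blast
    moreover have "(s i, 0) \<in> ?H"
      by (simp add: reception_zone_def embed_station_def)
    ultimately show ?thesis by (simp only: insert_subset)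
  qed
  from this[of 1] this[of "-1"] have "?half 1 \<union> ?half (-1) \<subseteq> ?H" by simp
  \<comment> \<open>Every point other than \<open>(s i, 0)\<close> is an inverse image for one of
    the two signs, and membership is the same condition on z for both.\<close>
  moreover have "?H \<subseteq> ?half 1 \<union> ?half (-1)"
  proof
    fix p assume p: "p \<in> ?H"
    show "p \<in> ?half 1 \<union> ?half (-1)"
    proof (cases "p = (s i, 0)")
      case False
      then obtain \<sigma> z where "\<sigma> \<in> {1, -1}" "z \<in> paraboloid_region" "p = uninvert \<sigma> (s i) z"
        using uninvert_surj by metis
      then show ?thesis using p mem_iff[of \<sigma> z] by auto
    qed simp
  qed
  moreover have "connected (?half \<sigma>)" for \<sigma>
  proof (rule connected_insert_uninvert_image)
    show "\<psi> j \<ge> 0" if "j \<in> {1..n} - {i}" for j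
      using assms(5)[of j] that by simp
  qed (use assms(1,2) in simp_all)
  \<comment> \<open>The halves share the point \<open>(s i, 0)\<close>.\<close>
  then have "connected (?half 1 \<union> ?half (-1))"
    by (intro connected_Un) blast+
  ultimately show "connected ?H"
    by (metis subset_antisym)
qed

end
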